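(* For every integer $p\geq 0$, $$\lim_{n\to\infty}\frac{2^{2p+n+1}(2p)!}{\binom{n}{n/2}}\sum_{k=0}^\infty \frac{\binom{2k}{k}G_p(k)}{4^k(2k+n+1)}=\pi^{2p+1},$$ and for every integer $p\geq 1$, $$\lim_{n\to\infty}\frac{2^{2p+n-1}(2p-1)!}{\binom{n}{n/2}}\sum_{k=1}^\infty \frac{4^kH_p(k)}{\binom{2k}{k}k(2k+n)}=\pi^{2p},$$ where $n$ runs through the positive integers (both even and odd).
   Context: $G_0(k)=1$ and for $p\ge 1$, $G_p(k)=\sum_{n_1=0}^{k-1}\frac{1}{(2n_1+1)^2}\sum_{n_2=0}^{n_1-1}\frac{1}{(2n_2+1)^2}\cdots\sum_{n_p=0}^{n_{p-1}-1}\frac{1}{(2n_p+1)^2}$. $H_1(k)=1$ and for $p\ge 1$, $H_{p+1}(k)=\sum_{n_1=1}^{k-1}\frac{1}{(2n_1)^2}\sum_{n_2=1}^{n_1-1}\frac{1}{(2n_2)^2}\cdots\sum_{n_p=1}^{n_{p-1}-1}\frac{1}{(2n_p)^2}$. Empty sums are $0$. For even $n$, $\binom{n}{n/2}$ is the usual central binomial coefficient; for odd $n=2\ell+1$ it is interpreted as $\binom{n}{n/2}=\frac{\Gamma(2\ell+2)}{\Gamma(\ell+\frac32)^2}=\frac{4^{2\ell+1}}{\binom{2\ell}{\ell}(2\ell+1)\pi}$. *)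

theory Defs
  imports "HOL-Analysis.Analysis"
begin

text \<open>Both nested sums are defined by recursion on the depth: the part of the
  \<open>(p+1)\<close>-fold sum inside the outermost index \<open>n\<close> is the \<open>p\<close>-fold sum
  with upper bound \<open>n\<close>. For \<open>H\<close> the depth is one less than the index.\<close>

primrec G :: "nat \<Rightarrow> nat \<Rightarrow> real" where
  "G 0 k = 1"
| "G (Suc p) k = (\<Sum>n<k. 1 / (2 * real n + 1)\<^sup>2 * G p n)"

text \<open>\<open>H p\<close> is only meaningful for \<open>p \<ge> 1\<close>; the value at \<open>p = 0\<close> is a dummy.\<close>

fun H :: "nat \<Rightarrow> nat \<Rightarrow> real" where
  "H 0 k = 0"
| "H (Suc 0) k = 1"
| "H (Suc (Suc p)) k = (\<Sum>n=1..<k. 1 / (2 * real n)\<^sup>2 * H (Suc p) n)"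

text \<open>\<open>n\<close> choose \<open>n/2\<close>, for odd \<open>n = 2l+1\<close> interpreted through the Gamma function.\<close>

definition central_binom :: "nat \<Rightarrow> real" where
  "central_binom n =
     (if even n then real (n choose (n div 2))
      else let l = n div 2 in Gamma (2 * real l + 2) / (Gamma (real l + 3 / 2))\<^sup>2)"

lemma central_binom_odd:
  "central_binom (2 * l + 1) = 4 ^ (2 * l + 1) / (real ((2 * l) choose l) * (2 * real l + 1) * pi)"
proof -
  have G1: "Gamma (x + 1) = x * Gamma x" if "x > 0" for x :: real
    using that by (intro Gamma_plus1) (auto elim!: nonpos_Ints_cases)
  have half: "Gamma (real l + 3 / 2) = fact (2 * l + 1) / (2 * 4 ^ l * fact l) * sqrt pi"
  proof (induction l)
    case 0
    show ?case
      using G1[of "1/2"] by (simp add: Gamma_one_half_real)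
  next
    case (Suc l)
    have "Gamma (real (Suc l) + 3 / 2) = (real l + 3 / 2) * Gamma (real l + 3 / 2)"
      using G1[of "real l + 3/2"] by (simp add: algebra_simps)
    also have "\<dots> = (real l + 3 / 2) * (fact (2 * l + 1) / (2 * 4 ^ l * fact l) * sqrt pi)"
      by (simp only: Suc)
    also have "\<dots> = fact (2 * Suc l + 1) / (2 * 4 ^ Suc l * fact (Suc l)) * sqrt pi"
      by (simp add: divide_simps)
    finally show ?case .
  qed
  have num: "Gamma (2 * real l + 2) = fact (2 * l + 1)"
    using Gamma_fact[of "2 * l + 1", where 'a = real] by (simp add: algebra_simps)
  have bin: "real ((2 * l) choose l) = fact (2 * l) / (fact l * fact l)"
    by (simp add: binomial_fact)
  have pw: "(4::real) ^ (2 * l + 1) = 4 * (4 ^ l * 4 ^ l)"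
    by (simp add: power_add mult_2)
  have "central_binom (2 * l + 1) = fact (2 * l + 1) / (fact (2 * l + 1) / (2 * 4 ^ l * fact l) * sqrt pi)\<^sup>2"
    by (simp add: central_binom_def num half Let_def del: fact_Suc)
  also have "\<dots> = 4 * (4 ^ l * 4 ^ l) * (fact l * fact l) / (fact (2 * l + 1) * pi)"
    by (simp add: power_mult_distrib power_divide real_sqrt_pow2[OF pi_ge_zero])
       (simp add: power2_eq_square)
  also have "\<dots> = 4 ^ (2 * l + 1) / (real ((2 * l) choose l) * (2 * real l + 1) * pi)"
    unfolding bin pw by (simp add: algebra_simps)
  finally show ?thesis .
qed

end

theory Submission
  imports Defs "HOL-Real_Asymp.Real_Asymp"
begin

text \<open>Put \<open>a k = binom(2k,k)/4^k\<close>. Without the factors \<open>G p k\<close> the first series is the Wallis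
  integral \<open>W n = \<Sum>k. a k / (2k+n+1) = (\<pi>/2) central_binom n / 2^n\<close>. As \<open>n\<close> grows, the normalised
  weights \<open>a k / ((2k+n+1) W n)\<close> tend to \<open>0\<close> for each fixed \<open>k\<close>, so by Toeplitz' theorem weighted
  means of a convergent sequence tend to its limit. Hence the first limit only needs
  \<open>lim G p k = (\<pi>/2)^(2p) / (2p)!\<close>. The second series has the weights of \<open>W (n-1)\<close> applied
  to \<open>H p k / (k (a k)^2)\<close>, where \<open>k (a k)^2\<close> tends to \<open>1/\<pi>\<close> by Wallis' product and
  \<open>lim H p k = (\<pi>/2)^(2p-2) / (2p-1)!\<close>. The limits of \<open>G\<close> and \<open>H\<close>, elementary symmetric
  functions of \<open>1/(2n+1)^2\<close> and \<open>1/(2n)^2\<close>, are read off the products of cosine and sine.\<close>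

section \<open>Elementary symmetric sums\<close>

text \<open>The elementary symmetric polynomial of degree \<open>p\<close> in \<open>x 0\<close>,
  ..., \<open>x (k - 1)\<close>, organised by its largest index. This is the recursion of
  \<open>G\<close>, so both nested sums become instances.\<close>

primrec esum :: "(nat \<Rightarrow> real) \<Rightarrow> nat \<Rightarrow> nat \<Rightarrow> real" where
  "esum x 0 k = 1"
| "esum x (Suc p) k = (\<Sum>n<k. x n * esum x p n)"

lemma esum_eq_0: "k < p \<Longrightarrow> esum x p k = 0"
proof (induction p arbitrary: k)
  case (Suc p)
  then show ?case by (auto intro!: sum.neutral)
qed auto

text \<open>The factor with index \<open>k\<close> acts on coefficients as the Pascal-type rule
  \<open>esum x (Suc p) (Suc k) = esum x (Suc p) k + x k * esum x p k\<close>.\<close>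

lemma prod_eq_sum_esum: "(\<Prod>n<k. 1 + x n * t) = (\<Sum>p\<le>k. esum x p k * t ^ p)"
proof (induction k)
  case (Suc k)
  have "(\<Sum>p\<le>Suc k. esum x p (Suc k) * t ^ p)
      = 1 + (\<Sum>p\<le>k. esum x (Suc p) k * t ^ Suc p) + (\<Sum>p\<le>k. x k * esum x p k * t ^ Suc p)"
    by (subst sum.atMost_Suc_shift) (simp add: algebra_simps sum.distrib)
  also have "1 + (\<Sum>p\<le>k. esum x (Suc p) k * t ^ Suc p) = (\<Sum>p\<le>Suc k. esum x p k * t ^ p)"
    by (subst sum.atMost_Suc_shift) simp
  \<comment> \<open>The added top term has degree \<open>k + 1\<close> in only \<open>k\<close>
    variables, hence vanishes.\<close>
  also have "\<dots> = (\<Sum>p\<le>k. esum x p k * t ^ p)"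
    by (simp add: esum_eq_0 del: esum.simps)
  also have "(\<Sum>p\<le>k. x k * esum x p k * t ^ Suc p) = x k * t * (\<Sum>p\<le>k. esum x p k * t ^ p)"
    by (simp add: sum_distrib_left algebra_simps)
  finally have eq: "(\<Sum>p\<le>Suc k. esum x p (Suc k) * t ^ p)
      = (\<Sum>p\<le>k. esum x p k * t ^ p) + x k * t * (\<Sum>p\<le>k. esum x p k * t ^ p)" .
  show ?case
    unfolding eq prod.lessThan_Suc Suc by (simp only: algebra_simps mult_1_right)
qed simp

lemma esum_nonneg: "(\<And>n. x n \<ge> 0) \<Longrightarrow> esum x p k \<ge> 0"
  by (induction p arbitrary: k) (auto intro!: sum_nonneg)

lemma incseq_esum:
  assumes "\<And>n. x n \<ge> 0"
  shows "incseq (esum x p)"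
proof (rule incseq_SucI)
  fix k show "esum x p k \<le> esum x p (Suc k)"
    by (cases p) (auto intro!: mult_nonneg_nonneg esum_nonneg assms)
qed

text \<open>Dropping the order condition on the indices leaves a power of the full sum. The bound is
  uniform in \<open>k\<close>: it gives convergence and later a geometric majorant.\<close>

lemma esum_le:
  assumes "\<And>n. x n \<ge> 0" "summable x"
  shows "esum x p k \<le> suminf x ^ p"
proof (induction p arbitrary: k)
  case (Suc p)
  have "esum x (Suc p) k \<le> (\<Sum>n<k. x n * suminf x ^ p)"
    using Suc assms by (auto intro!: sum_mono mult_left_mono)
  also have "\<dots> = (\<Sum>n<k. x n) * suminf x ^ p"
    by (simp add: sum_distrib_right)
  also have "\<dots> \<le> suminf x * suminf x ^ p"
    using assms by (intro mult_right_mono sum_le_suminf zero_le_power suminf_nonneg) auto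
  finally show ?case by simp
qed auto

lemma convergent_esum:
  assumes "\<And>n. x n \<ge> 0" "summable x"
  shows "convergent (esum x p)"
proof -
  have "incseq (esum x p)"
    by (rule incseq_esum) (rule assms)
  moreover have "\<forall>k. esum x p k \<le> suminf x ^ p"
    using esum_le[of x p] assms by blast
  ultimately obtain L where "esum x p \<longlonglongrightarrow> L"
    by (rule incseq_convergent)
  thus ?thesis by (rule convergentI)
qed

text \<open>Tannery's theorem lets \<open>k\<close> tend to infinity inside the sum over
  \<open>p\<close>; the majorant is the geometric series with ratio
  \<open>\<bar>t\<bar> * suminf x\<close>.\<close>

lemma esum_powser_sums:
  assumes x: "\<And>n. x n \<ge> 0" "summable x"
    and t: "\<bar>t\<bar> * suminf x < 1"
    and prod: "(\<lambda>k. \<Prod>n<k. 1 + x n * t) \<longlonglongrightarrow> P"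
  shows "(\<lambda>p. lim (esum x p) * t ^ p) sums P"
proof -
  define s where "s = suminf x"
  have s: "s \<ge> 0" unfolding s_def using x by (intro suminf_nonneg)
  have bnd: "\<bar>esum x p k * t ^ p\<bar> \<le> (\<bar>t\<bar> * s) ^ p" for p k
    using esum_le[of x p k] esum_nonneg[of x p k] x
    by (auto simp: abs_mult power_abs power_mult_distrib s_def mult.commute intro!: mult_left_mono)
  have "\<bar>\<bar>t\<bar> * s\<bar> < 1" using t s by (simp add: s_def)
  hence sm: "summable (\<lambda>p. (\<bar>t\<bar> * s) ^ p)"
    by (intro summable_geometric) simp
  have lim: "(\<lambda>k. esum x p k * t ^ p) \<longlonglongrightarrow> lim (esum x p) * t ^ p" for p
    using convergent_esum[of x p] x by (intro tendsto_mult_right) (simp add: convergent_LIMSEQ_iff)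
  have "eventually (\<lambda>(p, k). norm (esum x p k * t ^ p) \<le> (\<bar>t\<bar> * s) ^ p)
      (sequentially \<times>\<^sub>F sequentially)"
    by (rule always_eventually) (use bnd in auto)
  note tannery = tannerys_theorem[OF lim this sm sequentially_bot]
  have L: "(\<lambda>k. \<Sum>p. esum x p k * t ^ p) \<longlonglongrightarrow> (\<Sum>p. lim (esum x p) * t ^ p)"
    using tannery by (elim conjE)
  have "summable (\<lambda>p. norm (lim (esum x p) * t ^ p))"
    using tannery by (elim conjE)
  hence "summable (\<lambda>p. lim (esum x p) * t ^ p)"
    by (rule summable_norm_cancel)
  \<comment> \<open>For fixed \<open>k\<close> the series stops at \<open>p = k\<close>, so it is
    the finite product.\<close>
  moreover have "(\<Sum>p. esum x p k * t ^ p) = (\<Prod>n<k. 1 + x n * t)" for k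
    unfolding prod_eq_sum_esum by (rule suminf_finite) (auto simp: esum_eq_0)
  hence "(\<Sum>p. lim (esum x p) * t ^ p) = P"
    using L prod by (simp add: LIMSEQ_unique)
  ultimately show ?thesis
    by (simp add: sums_iff)
qed

section \<open>Uniqueness of power series coefficients from one side of 0\<close>

text \<open>Continuity of the sum at 0, tested along positive \<open>t\<close> only: the later
  application has \<open>t = y^2\<close>.\<close>

lemma powser_const_eq_0_right:
  fixes c :: "nat \<Rightarrow> real"
  assumes "r > 0" "\<And>t. 0 < t \<Longrightarrow> t < r \<Longrightarrow> (\<lambda>n. c n * t ^ n) sums 0"
  shows "c 0 = 0"
proof -
  have "summable (\<lambda>n. c n * (r/2) ^ n)"
    using assms(2)[of "r/2"] assms(1) by (auto simp: sums_iff)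
  hence "isCont (\<lambda>t. \<Sum>n. c n * t ^ n) 0"
    by (rule isCont_powser) (use assms in auto)
  hence "((\<lambda>t. \<Sum>n. c n * t ^ n) \<longlongrightarrow> c 0) (at_right 0)"
    by (simp add: isCont_def filterlim_at_split)
  moreover have "eventually (\<lambda>t. (\<Sum>n. c n * t ^ n) = 0) (at_right 0)"
    using eventually_at_right_real[OF assms(1)]
    by eventually_elim (use assms(2) in \<open>auto simp: sums_iff\<close>)
  ultimately have "((\<lambda>t::real. 0::real) \<longlongrightarrow> c 0) (at_right 0)"
    using tendsto_cong by force
  thus ?thesis by (simp add: tendsto_const_iff)
qed

text \<open>Once the constant coefficient vanishes, dividing by \<open>t\<close> shifts the
  coefficients down, and induction applies.\<close>

lemma powser_eq_0_right:
  fixes c :: "nat \<Rightarrow> real"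
  assumes "r > 0" "\<And>t. 0 < t \<Longrightarrow> t < r \<Longrightarrow> (\<lambda>n. c n * t ^ n) sums 0"
  shows "c n = 0"
  using assms(2)
proof (induction n arbitrary: c)
  case (0 c)
  thus ?case using powser_const_eq_0_right assms(1) by blast
next
  case (Suc n c)
  have c0: "c 0 = 0" using powser_const_eq_0_right assms(1) Suc.prems by blast
  have "(\<lambda>n. c (Suc n) * t ^ n) sums 0" if t: "0 < t" "t < r" for t
  proof -
    have "(\<lambda>n. c (Suc n) * t ^ Suc n) sums 0"
      using Suc.prems[OF t] c0 by (subst sums_Suc_iff) simp
    from sums_divide[OF this, of t] show ?thesis using t by simp
  qed
  from Suc.IH[OF this] show ?case by simp
qed

text \<open>Comparison of coefficients: the infinite product and the known expansion of
  \<open>f\<close> are both power series in \<open>t = y^2\<close>.\<close>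

lemma lim_esum_eqI:
  assumes x: "\<And>n. x n \<ge> 0" "summable x"
    and prod: "\<And>y. 0 < y \<Longrightarrow> y < 1 \<Longrightarrow> (\<lambda>k. \<Prod>n<k. 1 - x n * y\<^sup>2) \<longlonglongrightarrow> f y"
    and f: "\<And>y. 0 < y \<Longrightarrow> y < 1 \<Longrightarrow> (\<lambda>p. (- 1) ^ p * b p * y ^ (2 * p)) sums f y"
  shows "esum x p \<longlonglongrightarrow> b p"
proof -
  define s where "s = suminf x"
  have s: "s \<ge> 0" unfolding s_def using x by (intro suminf_nonneg)
  have "(- 1) ^ p * (lim (esum x p) - b p) = 0"
  proof (rule powser_eq_0_right)
    \<comment> \<open>This radius ensures both \<open>t * s < 1\<close>, for the interchange of
      limits, and \<open>t < 1\<close>, so that \<open>y = sqrt t\<close> stays below 1.\<close>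
    show "1 / (1 + s) > 0" using s by simp
    fix t :: real assume t: "0 < t" "t < 1 / (1 + s)"
    define y where "y = sqrt t"
    have "1 / (1 + s) \<le> 1" using s by simp
    hence "t < 1" using t by linarith
    hence y: "0 < y" "y < 1" "y\<^sup>2 = t" using t by (auto simp: y_def)
    have "t * (1 + s) < 1" using t s by (simp add: field_simps)
    hence ts: "t * s < 1" using t by (simp add: algebra_simps)
    have "(\<lambda>p. lim (esum x p) * (- t) ^ p) sums f y"
      using prod[OF y(1,2)] ts t by (intro esum_powser_sums x) (auto simp: y s_def)
    from sums_diff[OF this f[OF y(1,2)]]
    have "(\<lambda>n. lim (esum x n) * (- t) ^ n - (- 1) ^ n * b n * y ^ (2 * n)) sums 0"
      by simp
    moreover have "lim (esum x n) * (- t) ^ n - (- 1) ^ n * b n * y ^ (2 * n)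
        = (- 1) ^ n * (lim (esum x n) - b n) * t ^ n" for n
      unfolding power_mult y(3) power_minus[of t] by (simp add: algebra_simps)
    ultimately show "(\<lambda>n. (- 1) ^ n * (lim (esum x n) - b n) * t ^ n) sums 0"
      by simp
  qed
  hence "lim (esum x p) = b p" by simp
  thus ?thesis
    using convergent_esum[of x p] x by (simp add: convergent_LIMSEQ_iff)
qed

section \<open>Sine and cosine as infinite products\<close>

lemma sin_half_product:
  fixes y :: real
  assumes "y \<noteq> 0"
  shows "(\<lambda>k. \<Prod>n<k. 1 - 1 / (2 * real n)\<^sup>2 * y\<^sup>2) \<longlonglongrightarrow> sin (pi / 2 * y) / (pi / 2 * y)"
proof -
  \<comment> \<open>The factor at \<open>n = 0\<close> is 1 because \<open>1 / 0 = 0\<close>; the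
    rest is Euler's product at \<open>y / 2\<close>.\<close>
  have "(\<Prod>n<Suc k. 1 - 1 / (2 * real n)\<^sup>2 * y\<^sup>2) = (\<Prod>n=1..k. 1 - (y / 2)\<^sup>2 / (of_nat n)\<^sup>2)" for k
    by (induction k) (simp_all add: power_mult_distrib power_divide mult.commute)
  thus ?thesis
    using sin_product_formula_real'[of "y / 2"] assms
    by (subst filterlim_sequentially_Suc[symmetric]) (simp only:, simp add: mult.commute)
qed

text \<open>In Euler's product for \<open>sin (pi * y)\<close> the even-indexed factors form the
  product at \<open>y / 2\<close>. The odd-indexed ones are therefore a quotient of sines, which the
  double angle formula turns into a cosine.\<close>

lemma cos_half_product:
  fixes y :: real
  assumes "0 < y" "y < 1"
  shows "(\<lambda>k. \<Prod>n<k. 1 - 1 / (2 * real n + 1)\<^sup>2 * y\<^sup>2) \<longlonglongrightarrow> cos (pi / 2 * y)"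
proof -
  define A where "A = (\<lambda>(y::real) k. \<Prod>n=1..k. 1 - y\<^sup>2 / (of_nat n)\<^sup>2)"
  define C where "C = (\<lambda>k. \<Prod>n<k. 1 - 1 / (2 * real n + 1)\<^sup>2 * y\<^sup>2)"
  have A: "A y (2 * k) = A (y / 2) k * C k" for k
  proof (induction k)
    case (Suc k)
    have "A y (2 * Suc k) = A y (2 * k) * (1 - y\<^sup>2 / (2 * real k + 1)\<^sup>2) * (1 - y\<^sup>2 / (2 * real (Suc k))\<^sup>2)"
      by (simp add: A_def add_ac)
    also have "y\<^sup>2 / (2 * real (Suc k))\<^sup>2 = (y / 2)\<^sup>2 / (real (Suc k))\<^sup>2"
      by (simp add: power_divide power_mult_distrib del: of_nat_Suc)
    also have "A y (2 * k) * (1 - y\<^sup>2 / (2 * real k + 1)\<^sup>2) * (1 - (y / 2)\<^sup>2 / (real (Suc k))\<^sup>2)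
        = A (y / 2) (Suc k) * C (Suc k)"
      unfolding Suc by (simp add: A_def C_def del: of_nat_Suc)
    finally show ?case .
  qed (simp add: A_def C_def)
  \<comment> \<open>Since \<open>y < 1 < 2 * n\<close>, no factor vanishes and the division by the
    even part is legitimate.\<close>
  have nz: "A (y / 2) k \<noteq> 0" for k
  proof -
    have "y\<^sup>2 < (2 * real n)\<^sup>2" if "n \<ge> 1" for n
      using that assms by (intro power_strict_mono) auto
    thus ?thesis
      by (force simp: A_def power_mult_distrib field_simps)
  qed
  have pos: "sin (pi / 2 * y) > 0"
    using assms by (intro sin_gt_zero) (auto simp: mult_less_cancel_left1 intro: order.strict_trans)
  have "(\<lambda>k. A y (2 * k)) \<longlonglongrightarrow> sin (pi * y) / (pi * y)"
    unfolding A_def using assms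
    by (intro filterlim_compose[OF sin_product_formula_real'] mult_nat_left_at_top) auto
  moreover have "A (y / 2) \<longlonglongrightarrow> sin (pi * (y / 2)) / (pi * (y / 2))"
    unfolding A_def using assms by (intro sin_product_formula_real') auto
  ultimately have "(\<lambda>k. A y (2 * k) / A (y / 2) k) \<longlonglongrightarrow>
      (sin (pi * y) / (pi * y)) / (sin (pi * (y / 2)) / (pi * (y / 2)))"
    using assms pos by (intro tendsto_divide) auto
  moreover have "A y (2 * k) / A (y / 2) k = C k" for k
    using nz[of k] by (simp add: A)
  moreover have "sin (pi * y) = 2 * sin (pi / 2 * y) * cos (pi / 2 * y)"
    using sin_double[of "pi / 2 * y"] by simp
  hence "(sin (pi * y) / (pi * y)) / (sin (pi * (y / 2)) / (pi * (y / 2))) = cos (pi / 2 * y)"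
    using assms pos by (simp add: field_simps)
  ultimately show ?thesis
    unfolding C_def by simp
qed

section \<open>Limits of the nested sums\<close>

lemma summable_inverse_squares_affine:
  fixes c :: real
  assumes "c \<ge> 0"
  shows "summable (\<lambda>n. 1 / (2 * real n + c)\<^sup>2)"
proof (rule summable_comparison_test')
  show "summable (\<lambda>n. 1 / real n ^ 2)"
    using inverse_power_summable[of 2, where 'a = real] by (simp add: inverse_eq_divide)
  fix n :: nat assume n: "n \<ge> 1"
  have "real n ^ 2 \<le> (2 * real n + c)\<^sup>2"
    using assms by (intro power_mono) auto
  thus "norm (1 / (2 * real n + c)\<^sup>2) \<le> 1 / real n ^ 2"
    using n by (auto intro!: divide_left_mono mult_pos_pos zero_less_power add_pos_nonneg assms)
qed

lemma G_eq_esum: "G p k = esum (\<lambda>n. 1 / (2 * real n + 1)\<^sup>2) p k"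
  by (induction p arbitrary: k) auto

text \<open>The index \<open>n = 0\<close>, absent from \<open>H\<close>, contributes \<open>1 / 0 = 0\<close>.\<close>

lemma H_eq_esum: "H (Suc p) k = esum (\<lambda>n. 1 / (2 * real n)\<^sup>2) p k"
proof (induction p arbitrary: k)
  case (Suc p)
  have "H (Suc (Suc p)) k = (\<Sum>n=1..<k. 1 / (2 * real n)\<^sup>2 * esum (\<lambda>n. 1 / (2 * real n)\<^sup>2) p n)"
    by (simp only: H.simps Suc)
  also have "\<dots> = (\<Sum>n<k. 1 / (2 * real n)\<^sup>2 * esum (\<lambda>n. 1 / (2 * real n)\<^sup>2) p n)"
    by (intro sum.mono_neutral_left) auto
  finally show ?case by simp
qed simp

lemma G_tendsto: "G p \<longlonglongrightarrow> (pi / 2) ^ (2 * p) / fact (2 * p)"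
proof -
  have "esum (\<lambda>n. 1 / (2 * real n + 1)\<^sup>2) p \<longlonglongrightarrow> (pi / 2) ^ (2 * p) / fact (2 * p)"
  proof (rule lim_esum_eqI[OF _ summable_inverse_squares_affine cos_half_product])
    fix y :: real
    have "(- 1) ^ p * ((pi / 2) ^ (2 * p) / fact (2 * p)) * y ^ (2 * p)
        = (- 1) ^ p / fact (2 * p) * (pi / 2 * y) ^ (2 * p)" for p
      unfolding power_mult_distrib by simp
    thus "(\<lambda>p. (- 1) ^ p * ((pi / 2) ^ (2 * p) / fact (2 * p)) * y ^ (2 * p)) sums cos (pi / 2 * y)"
      using cos_paired[of "pi / 2 * y"] by (simp only:)
  qed auto
  moreover have "G p = esum (\<lambda>n. 1 / (2 * real n + 1)\<^sup>2) p"
    by (rule ext) (rule G_eq_esum)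
  ultimately show ?thesis by (simp only:)
qed

text \<open>Dividing the sine series by its argument lowers the exponent \<open>2 * p + 1\<close> to
  \<open>2 * p\<close> but keeps the factorial of \<open>2 * p + 1\<close>.\<close>

lemma H_tendsto: "H (Suc p) \<longlonglongrightarrow> (pi / 2) ^ (2 * p) / fact (2 * p + 1)"
proof -
  have "esum (\<lambda>n. 1 / (2 * real n)\<^sup>2) p \<longlonglongrightarrow> (pi / 2) ^ (2 * p) / fact (2 * p + 1)"
  proof (rule lim_esum_eqI[OF _ _ sin_half_product])
    fix y :: real assume y: "0 < y"
    have "(\<lambda>p. (- 1) ^ p / fact (2 * p + 1) * (pi / 2 * y) ^ (2 * p + 1) / (pi / 2 * y))
        sums (sin (pi / 2 * y) / (pi / 2 * y))"
      by (intro sums_divide sin_paired)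
    moreover have "(- 1) ^ p * ((pi / 2) ^ (2 * p) / fact (2 * p + 1)) * y ^ (2 * p)
        = (- 1) ^ p / fact (2 * p + 1) * (pi / 2 * y) ^ (2 * p + 1) / (pi / 2 * y)" for p
      unfolding power_mult_distrib power_add using y by (simp del: fact_Suc)
    ultimately show "(\<lambda>p. (- 1) ^ p * ((pi / 2) ^ (2 * p) / fact (2 * p + 1)) * y ^ (2 * p))
        sums (sin (pi / 2 * y) / (pi / 2 * y))"
      by (simp only:)
  qed (use summable_inverse_squares_affine[of 0] in auto)
  moreover have "H (Suc p) = esum (\<lambda>n. 1 / (2 * real n)\<^sup>2) p"
    by (rule ext) (rule H_eq_esum)
  ultimately show ?thesis by (simp only:)
qed

section \<open>Central binomial coefficients and Wallis series\<close>

text \<open>The Taylor coefficients of \<open>1 / sqrt (1 - x)\<close>, written \<open>a k\<close>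
  in the overview.\<close>

definition cbin :: "nat \<Rightarrow> real" where
  "cbin k = real ((2 * k) choose k) / 4 ^ k"

lemma cbin_0 [simp]: "cbin 0 = 1"
  by (simp add: cbin_def)

lemma cbin_pos [simp]: "cbin k > 0"
  by (simp add: cbin_def)

lemma cbin_Suc: "cbin (Suc k) = cbin k * (2 * real k + 1) / (2 * real k + 2)"
proof -
  have bin: "real ((2 * m) choose m) = fact (2 * m) / (fact m * fact m)" for m
    by (simp add: binomial_fact)
  show ?thesis
    unfolding cbin_def bin by (simp add: divide_simps) (simp add: algebra_simps)
qed

text \<open>The expression is exactly the \<open>k\<close>-th partial product of Wallis'
  formula.\<close>

lemma cbin_tendsto_wallis: "(\<lambda>k. 1 / (cbin k ^ 2 * (2 * real k + 1))) \<longlonglongrightarrow> pi / 2"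
proof -
  have "(\<Prod>j=1..k. 4 * real j ^ 2 / (4 * real j ^ 2 - 1)) = 1 / (cbin k ^ 2 * (2 * real k + 1))" for k
  proof (induction k)
    case (Suc k)
    have *: "4 * real (Suc k) ^ 2 - 1 = (2 * real k + 1) * (2 * real k + 3)"
      by (simp add: power2_eq_square algebra_simps)
    have "(\<Prod>j=1..Suc k. 4 * real j ^ 2 / (4 * real j ^ 2 - 1))
        = 1 / (cbin k ^ 2 * (2 * real k + 1)) * (4 * real (Suc k) ^ 2 / (4 * real (Suc k) ^ 2 - 1))"
      unfolding Suc[symmetric] by (simp add: prod.nat_ivl_Suc' mult.commute)
    also have "\<dots> = 1 / (cbin (Suc k) ^ 2 * (2 * real (Suc k) + 1))"
      unfolding * cbin_Suc
      by (simp add: divide_simps add_nonneg_eq_0_iff) (simp add: power2_eq_square algebra_simps)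
    finally show ?case .
  qed simp
  thus ?thesis using wallis by simp
qed

lemma cbin_tendsto_0: "cbin \<longlonglongrightarrow> 0"
proof -
  have "(\<lambda>k. inverse (2 * real k + 1)) \<longlonglongrightarrow> 0"
    by real_asymp
  from tendsto_divide[OF this cbin_tendsto_wallis]
  have "(\<lambda>k. inverse (2 * real k + 1) / (1 / (cbin k ^ 2 * (2 * real k + 1)))) \<longlonglongrightarrow> 0"
    by simp
  also have "(\<lambda>k. inverse (2 * real k + 1) / (1 / (cbin k ^ 2 * (2 * real k + 1)))) = (\<lambda>k. cbin k ^ 2)"
    by (simp add: fun_eq_iff divide_simps add_nonneg_eq_0_iff)
  finally have "(\<lambda>k. sqrt (cbin k ^ 2)) \<longlonglongrightarrow> sqrt 0"
    by (rule tendsto_real_sqrt)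
  thus ?thesis by (simp add: less_imp_le)
qed

text \<open>The Wallis limit times \<open>(2 * k + 1) / k\<close>, which tends to 2. It lets the
  factor \<open>1 / (k * cbin k)\<close> of the second series be read as \<open>cbin k\<close> times
  a convergent sequence.\<close>

lemma inverse_cbin_square_tendsto: "(\<lambda>k. 1 / (real k * cbin k ^ 2)) \<longlonglongrightarrow> pi"
proof -
  have "(\<lambda>k. (2 * real k + 1) / real k) \<longlonglongrightarrow> 2"
    by real_asymp
  from tendsto_mult[OF this cbin_tendsto_wallis] show ?thesis
    by (rule filterlim_cong[THEN iffD1, rotated -1])
       (auto simp: divide_simps add_nonneg_eq_0_iff)
qed

section \<open>The Wallis integrals as series\<close>

text \<open>Termwise integration of \<open>x^n / sqrt (1 - x^2)\<close> over [0, 1] produces this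
  series. All its properties below come from the series itself.\<close>

definition wseries :: "nat \<Rightarrow> real" where
  "wseries n = (\<Sum>k. cbin k / (2 * real k + real n + 1))"

text \<open>The terms are the differences \<open>cbin k - cbin (Suc k)\<close>, so the sum
  telescopes. It also majorises the series for every other \<open>n\<close>.\<close>

lemma wseries_1_sums: "(\<lambda>k. cbin k / (2 * real k + 2)) sums 1"
proof -
  have "(\<lambda>k. cbin k - cbin (Suc k)) sums (cbin 0 - 0)"
    by (intro telescope_sums' cbin_tendsto_0)
  also have "(\<lambda>k. cbin k - cbin (Suc k)) = (\<lambda>k. cbin k / (2 * real k + 2))"
    by (simp add: fun_eq_iff cbin_Suc divide_simps) (simp add: algebra_simps)
  finally show ?thesis by simp
qed

lemma summable_cbin:
  assumes "convergent c"
  shows "summable (\<lambda>k. cbin k * c k / (2 * real k + real n + 1))"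
proof -
  obtain B where B: "B > 0" "\<And>k. norm (c k) \<le> B"
    using convergent_imp_Bseq[OF assms] by (elim BseqE) auto
  show ?thesis
  proof (rule summable_comparison_test')
    show "summable (\<lambda>k. 2 * B * (cbin k / (2 * real k + 2)))"
      using wseries_1_sums by (intro summable_mult) (simp add: sums_iff)
    fix k :: nat
    \<comment> \<open>The factor 2 makes the comparison with \<open>2 * k + 2\<close> valid also for
      \<open>n = 0\<close>.\<close>
    have "\<bar>cbin k * c k\<bar> * (1 / (2 * real k + real n + 1)) \<le> (cbin k * B) * (2 / (2 * real k + 2))"
      using B(2)[of k] B(1)
      by (intro mult_mono) (auto simp: abs_mult less_imp_le divide_simps intro!: mult_mono)
    thus "norm (cbin k * c k / (2 * real k + real n + 1)) \<le> 2 * B * (cbin k / (2 * real k + 2))"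
      by (simp add: abs_divide mult_ac)
  qed
qed

lemma summable_wseries: "summable (\<lambda>k. cbin k / (2 * real k + real n + 1))"
  using summable_cbin[of "\<lambda>_. 1" n] by (simp add: convergent_const)

lemma wseries_pos: "wseries n > 0"
  unfolding wseries_def
  by (intro suminf_pos summable_wseries divide_pos_pos) (auto intro: add_nonneg_pos)

lemma wseries_Suc_le: "wseries (Suc n) \<le> wseries n"
  unfolding wseries_def
  by (intro suminf_le summable_wseries divide_left_mono) (auto simp: less_imp_le)

lemma wseries_1: "wseries (Suc 0) = 1"
  using wseries_1_sums by (simp add: wseries_def sums_iff add.assoc)

text \<open>A telescoping substitute for the integration by parts behind the Wallis
  recursion.\<close>

lemma wseries_Suc_Suc: "(real n + 2) * wseries (Suc (Suc n)) = (real n + 1) * wseries n"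
proof -
  \<comment> \<open>Chosen so that \<open>f k - f (Suc k)\<close> is the \<open>k\<close>-th term of
    the difference of both sides; as \<open>f 0 = 0\<close> and \<open>f\<close> tends to 0, that
    difference is 0.\<close>
  define f where "f = (\<lambda>k. 2 * real k * cbin k / (2 * real k + real n + 1))"
  have "(\<lambda>k. 2 * real k / (2 * real k + real n + 1)) \<longlonglongrightarrow> 1"
    by real_asymp
  from tendsto_mult[OF cbin_tendsto_0 this] have "f \<longlonglongrightarrow> 0"
    by (simp add: f_def mult_ac)
  hence "(\<lambda>k. f k - f (Suc k)) sums (f 0 - 0)"
    by (rule telescope_sums')
  moreover have "f k - f (Suc k) = (real n + 2) * (cbin k / (2 * real k + real (Suc (Suc n)) + 1)) -
      (real n + 1) * (cbin k / (2 * real k + real n + 1))" for k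
    by (simp add: f_def cbin_Suc divide_simps add_nonneg_eq_0_iff) (simp add: algebra_simps)
  moreover have "(\<lambda>k. (real n + 2) * (cbin k / (2 * real k + real (Suc (Suc n)) + 1)) -
      (real n + 1) * (cbin k / (2 * real k + real n + 1))) sums
      ((real n + 2) * wseries (Suc (Suc n)) - (real n + 1) * wseries n)"
    unfolding wseries_def by (intro sums_diff sums_mult summable_sums summable_wseries)
  ultimately show ?thesis
    using sums_unique2 by (fastforce simp: f_def)
qed

lemma wseries_odd: "wseries (2 * m + 1) = 1 / (cbin m * (2 * real m + 1))"
proof (induction m)
  case (Suc m)
  have "wseries (2 * Suc m + 1) = (2 * real m + 2) / (2 * real m + 3) * wseries (2 * m + 1)"
    using wseries_Suc_Suc[of "2 * m + 1"] by (simp add: field_simps)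
  thus ?case
    unfolding Suc cbin_Suc by (simp add: field_simps)
qed (simp add: wseries_1)

lemma wseries_even: "wseries (2 * m) = wseries 0 * cbin m"
proof (induction m)
  case (Suc m)
  have "wseries (2 * Suc m) = (2 * real m + 1) / (2 * real m + 2) * wseries (2 * m)"
    using wseries_Suc_Suc[of "2 * m"] by (simp add: field_simps)
  thus ?case
    unfolding Suc cbin_Suc by (simp add: field_simps)
qed simp

text \<open>The odd values squeeze the even ones, and Wallis' product evaluates both bounds.\<close>

lemma wseries_0: "wseries 0 = pi / 2"
proof (rule antisym)
  define u where "u = (\<lambda>k. 1 / (cbin k ^ 2 * (2 * real k + 1)))"
  have u: "u \<longlonglongrightarrow> pi / 2" unfolding u_def by (rule cbin_tendsto_wallis)
  have "u m \<le> wseries 0" for m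
  proof -
    have "1 / (cbin m * (2 * real m + 1)) \<le> wseries 0 * cbin m"
      using wseries_Suc_le[of "2 * m"] wseries_odd[of m] wseries_even[of m] by simp
    hence "1 / (cbin m * (2 * real m + 1)) / cbin m \<le> wseries 0"
      by (simp only: pos_divide_le_eq[OF cbin_pos])
    thus ?thesis by (simp add: u_def power2_eq_square mult_ac)
  qed
  thus "pi / 2 \<le> wseries 0"
    by (intro LIMSEQ_le_const2[OF u]) auto
  have "wseries 0 \<le> (2 * real m + 2) / (2 * real m + 1) * u m" for m
  proof -
    have "wseries 0 * cbin (Suc m) \<le> 1 / (cbin m * (2 * real m + 1))"
      using wseries_Suc_le[of "2 * m + 1"] wseries_odd[of m] wseries_even[of "Suc m"] by simp
    hence "wseries 0 \<le> 1 / (cbin m * (2 * real m + 1)) / cbin (Suc m)"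
      by (simp only: pos_le_divide_eq[OF cbin_pos])
    thus ?thesis by (simp add: u_def power2_eq_square mult_ac cbin_Suc)
  qed
  moreover have "(\<lambda>m. (2 * real m + 2) / (2 * real m + 1) * u m) \<longlonglongrightarrow> 1 * (pi / 2)"
    by (rule tendsto_mult[OF _ u]) real_asymp
  ultimately show "wseries 0 \<le> pi / 2"
    by (intro LIMSEQ_le_const) auto
qed

text \<open>Parity disappears here: for even \<open>n\<close> the factor \<open>2 / pi\<close>
  cancels \<open>wseries 0\<close>, for odd \<open>n\<close> it is the \<open>1 / pi\<close> of the
  Gamma interpretation.\<close>

lemma central_binom_eq: "central_binom n = 2 ^ n * (2 / pi) * wseries n"
proof (cases "even n")
  case True
  then obtain m where n: "n = 2 * m" by (elim evenE)
  show ?thesis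
    unfolding n wseries_even wseries_0
    by (simp add: central_binom_def cbin_def power_mult)
next
  case False
  then obtain m where n: "n = 2 * m + 1" by (elim oddE)
  have p: "(4::real) ^ (2 * m + 1) = 2 ^ (2 * m + 1) * 2 * 4 ^ m"
    by (simp add: power_mult power_mult_distrib[symmetric])
  show ?thesis
    unfolding n central_binom_odd wseries_odd p
    by (simp add: cbin_def field_simps)
qed

text \<open>By the two-step recursion the product does not depend on \<open>n\<close>, and its value
  is read off at \<open>n = 0\<close>.\<close>

lemma wseries_mult_Suc: "(real n + 1) * wseries n * wseries (Suc n) = pi / 2"
proof (induction n)
  case (Suc n)
  have "(real (Suc n) + 1) * wseries (Suc n) * wseries (Suc (Suc n))
      = wseries (Suc n) * ((real n + 2) * wseries (Suc (Suc n)))"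
    by (simp add: algebra_simps)
  also have "\<dots> = (real n + 1) * wseries n * wseries (Suc n)"
    unfolding wseries_Suc_Suc by (simp add: algebra_simps)
  finally show ?case by (simp only: Suc)
qed (simp add: wseries_0 wseries_1)

text \<open>Monotonicity gives the lower bound, and together with the recursion the upper one. The
  ratio corrects the index shift in the second limit.\<close>

lemma wseries_ratio_tendsto: "(\<lambda>n. wseries n / wseries (Suc n)) \<longlonglongrightarrow> 1"
proof (rule tendsto_sandwich)
  show "\<forall>\<^sub>F n in sequentially. 1 \<le> wseries n / wseries (Suc n)"
    using wseries_Suc_le wseries_pos by (intro always_eventually) (simp add: pos_le_divide_eq)
  have "wseries n / wseries (Suc n) \<le> (real n + 2) / (real n + 1)" for n
  proof -
    have "(real n + 1) * wseries n \<le> (real n + 2) * wseries (Suc n)"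
      unfolding wseries_Suc_Suc[symmetric] by (intro mult_left_mono wseries_Suc_le) auto
    thus ?thesis using wseries_pos[of "Suc n"] by (simp add: divide_simps mult_ac)
  qed
  thus "\<forall>\<^sub>F n in sequentially. wseries n / wseries (Suc n) \<le> (real n + 2) / (real n + 1)"
    by simp
  show "(\<lambda>n. (real n + 2) / (real n + 1)) \<longlonglongrightarrow> 1"
    by real_asymp
qed simp

text \<open>Monotonicity and the product formula give
  \<open>(n + 1) * (wseries n)^2 \<ge> pi / 2\<close>. Hence each single normalised weight tends to
  0.\<close>

lemma inverse_wseries_tendsto: "(\<lambda>n. 1 / ((real n + 1) * wseries n)) \<longlonglongrightarrow> 0"
proof -
  have "(1 / ((real n + 1) * wseries n))\<^sup>2 \<le> 2 / pi / (real n + 1)" for n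
  proof -
    have "pi / 2 \<le> (real n + 1) * wseries n * wseries n"
      unfolding wseries_mult_Suc[of n, symmetric]
      using wseries_pos[of n] by (intro mult_left_mono wseries_Suc_le) auto
    hence le: "(real n + 1) * (pi / 2) \<le> (real n + 1) * ((real n + 1) * wseries n * wseries n)"
      by (intro mult_left_mono) auto
    have "(1 / ((real n + 1) * wseries n))\<^sup>2 = 1 / ((real n + 1) * ((real n + 1) * wseries n * wseries n))"
      by (simp only: power2_eq_square times_divide_times_eq mult_1_left mult_ac)
    also have "\<dots> \<le> 1 / ((real n + 1) * (pi / 2))"
      by (rule divide_left_mono[OF le]) (use wseries_pos[of n] in simp_all)
    also have "\<dots> = 2 / pi / (real n + 1)"
      by simp
    finally show ?thesis .
  qed
  hence le: "\<forall>\<^sub>F n in sequentially. (1 / ((real n + 1) * wseries n))\<^sup>2 \<le> 2 / pi / (real n + 1)"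
    by (intro always_eventually allI)
  have lim: "(\<lambda>n. 2 / pi / (real n + 1)) \<longlonglongrightarrow> 0"
    by real_asymp
  have "(\<lambda>n. (1 / ((real n + 1) * wseries n))\<^sup>2) \<longlonglongrightarrow> 0"
    by (rule tendsto_sandwich[OF _ le tendsto_const lim]) simp
  thus ?thesis by (simp only: power_tendsto_0_iff zero_less_numeral)
qed

section \<open>Toeplitz averaging\<close>

text \<open>Finitely many terms are killed by their vanishing weights; the others are small, and the
  normalised weights sum to 1.\<close>

lemma cbin_weighted_mean_null:
  assumes c: "c \<longlonglongrightarrow> 0"
  shows "(\<lambda>n. (\<Sum>k. cbin k * c k / (2 * real k + real n + 1)) / wseries n) \<longlonglongrightarrow> 0"
proof (rule LIMSEQ_I)
  fix e :: real assume e: "e > 0"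
  obtain N where N: "\<And>k. k \<ge> N \<Longrightarrow> \<bar>c k\<bar> < e / 2"
    using LIMSEQ_D[OF c, of "e / 2"] e by auto
  define M where "M = (\<Sum>k<N. cbin k * \<bar>c k\<bar>)"
  have abs: "summable (\<lambda>k. cbin k * \<bar>c k\<bar> / (2 * real k + real n + 1))" for n
    using tendsto_rabs_zero[OF c] by (intro summable_cbin) (auto simp: convergent_def)
  have bnd: "\<bar>(\<Sum>k. cbin k * c k / (2 * real k + real n + 1)) / wseries n\<bar>
      \<le> M * (1 / ((real n + 1) * wseries n)) + e / 2" for n
  proof -
    have "\<bar>\<Sum>k. cbin k * c k / (2 * real k + real n + 1)\<bar>
        \<le> (\<Sum>k. cbin k * \<bar>c k\<bar> / (2 * real k + real n + 1))"
      using summable_rabs[of "\<lambda>k. cbin k * c k / (2 * real k + real n + 1)"] abs[of n]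
      by (simp add: abs_mult abs_divide less_imp_le)
    \<comment> \<open>For \<open>k < N\<close> the denominator shrinks to \<open>n + 1\<close>,
      giving \<open>M / (n + 1)\<close>. The tail bound is added for all \<open>k\<close>, so that
      it sums to \<open>e / 2 * wseries n\<close>.\<close>
    also have "\<dots> \<le> (\<Sum>k. (if k < N then cbin k * \<bar>c k\<bar> / (real n + 1) else 0)
        + e / 2 * (cbin k / (2 * real k + real n + 1)))"
    proof (intro suminf_le abs summable_add summable_mult summable_wseries)
      show "summable (\<lambda>k. if k < N then cbin k * \<bar>c k\<bar> / (real n + 1) else 0)"
        by (rule summable_finite[of "{..<N}"]) auto
      fix k
      show "cbin k * \<bar>c k\<bar> / (2 * real k + real n + 1)
          \<le> (if k < N then cbin k * \<bar>c k\<bar> / (real n + 1) else 0)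
            + e / 2 * (cbin k / (2 * real k + real n + 1))"
      proof (cases "k < N")
        case True
        have "cbin k * \<bar>c k\<bar> / (2 * real k + real n + 1) \<le> cbin k * \<bar>c k\<bar> / (real n + 1)"
          by (intro divide_left_mono) (auto simp: less_imp_le)
        moreover have "e / 2 * (cbin k / (2 * real k + real n + 1)) \<ge> 0"
          using e by (simp add: less_imp_le)
        ultimately show ?thesis using True by simp
      next
        case False
        have "\<bar>c k\<bar> * (cbin k / (2 * real k + real n + 1))
            \<le> e / 2 * (cbin k / (2 * real k + real n + 1))"
          using N[of k] False by (intro mult_right_mono) (auto simp: less_imp_le)
        thus ?thesis using False by (simp add: mult_ac)
      qed
    qed
    also have "\<dots> = M / (real n + 1) + e / 2 * wseries n"
    proof -
      have "(\<lambda>k. if k < N then cbin k * \<bar>c k\<bar> / (real n + 1) else 0) sums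
          (\<Sum>k<N. if k < N then cbin k * \<bar>c k\<bar> / (real n + 1) else 0)"
        by (rule sums_finite) auto
      hence "(\<lambda>k. if k < N then cbin k * \<bar>c k\<bar> / (real n + 1) else 0) sums (M / (real n + 1))"
        by (simp add: M_def sum_divide_distrib)
      from sums_add[OF this sums_mult[OF summable_sums[OF summable_wseries[of n]], of "e / 2"]]
      show ?thesis by (simp add: sums_iff wseries_def)
    qed
    finally have "\<bar>\<Sum>k. cbin k * c k / (2 * real k + real n + 1)\<bar> / wseries n
        \<le> (M / (real n + 1) + e / 2 * wseries n) / wseries n"
      using wseries_pos[of n] by (intro divide_right_mono) auto
    thus ?thesis
      using wseries_pos[of n] by (simp add: abs_divide add_divide_distrib)
  qed
  have "(\<lambda>n. M * (1 / ((real n + 1) * wseries n))) \<longlonglongrightarrow> 0"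
    by (rule tendsto_mult_right_zero[OF inverse_wseries_tendsto])
  then obtain n0 where n0: "\<And>n. n \<ge> n0 \<Longrightarrow> \<bar>M * (1 / ((real n + 1) * wseries n))\<bar> < e / 2"
    using LIMSEQ_D[of _ 0 "e / 2"] e by fastforce
  show "\<exists>n0. \<forall>n\<ge>n0. norm ((\<Sum>k. cbin k * c k / (2 * real k + real n + 1)) / wseries n - 0) < e"
  proof (intro exI allI impI)
    fix n assume "n \<ge> n0"
    with n0[of n] bnd[of n]
    show "norm ((\<Sum>k. cbin k * c k / (2 * real k + real n + 1)) / wseries n - 0) < e"
      unfolding real_norm_def diff_zero by linarith
  qed
qed

text \<open>Subtracting \<open>L\<close> reduces to null sequences, because the total weight is
  \<open>wseries n\<close>.\<close>

lemma cbin_weighted_mean_tendsto: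
  assumes c: "c \<longlonglongrightarrow> L"
  shows "(\<lambda>n. (\<Sum>k. cbin k * c k / (2 * real k + real n + 1)) / wseries n) \<longlonglongrightarrow> L"
proof -
  have null: "(\<lambda>k. c k - L) \<longlonglongrightarrow> 0"
    using c by (simp add: LIM_zero)
  have "(\<Sum>k. cbin k * c k / (2 * real k + real n + 1)) / wseries n
      = (\<Sum>k. cbin k * (c k - L) / (2 * real k + real n + 1)) / wseries n + L" for n
  proof -
    have "(\<lambda>k. cbin k * (c k - L) / (2 * real k + real n + 1)
          + L * (cbin k / (2 * real k + real n + 1)))
        sums ((\<Sum>k. cbin k * (c k - L) / (2 * real k + real n + 1)) + L * wseries n)"
      unfolding wseries_def using null
      by (intro sums_add sums_mult summable_sums summable_wseries summable_cbin)
         (auto simp: convergent_def)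
    moreover have "(\<lambda>k. cbin k * (c k - L) / (2 * real k + real n + 1)
          + L * (cbin k / (2 * real k + real n + 1))) = (\<lambda>k. cbin k * c k / (2 * real k + real n + 1))"
      by (simp add: fun_eq_iff add_divide_distrib[symmetric] algebra_simps)
    ultimately show ?thesis
      using wseries_pos[of n] by (simp add: sums_iff add_divide_distrib)
  qed
  thus ?thesis
    using tendsto_add[OF cbin_weighted_mean_null[OF null] tendsto_const[of L]] by simp
qed

section \<open>The two limits\<close>

lemma G_series:
  shows "summable (\<lambda>k. real ((2 * k) choose k) * G p k / (4 ^ k * real (2 * k + n + 1)))"
    and "(\<lambda>n. 2 ^ (2 * p + n + 1) * fact (2 * p) / central_binom n *
          (\<Sum>k. real ((2 * k) choose k) * G p k / (4 ^ k * real (2 * k + n + 1))))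
        \<longlonglongrightarrow> pi ^ (2 * p + 1)"
proof -
  have eq: "real ((2 * k) choose k) * G p k / (4 ^ k * real (2 * k + n + 1))
      = cbin k * G p k / (2 * real k + real n + 1)" for k n
    by (simp add: cbin_def)
  show "summable (\<lambda>k. real ((2 * k) choose k) * G p k / (4 ^ k * real (2 * k + n + 1)))"
    unfolding eq using G_tendsto by (intro summable_cbin) (auto simp: convergent_def)
  \<comment> \<open>The power \<open>2 ^ n\<close> cancels against \<open>central_binom n\<close>,
    and the remaining factor 2 against \<open>2 / pi\<close> leaves \<open>pi\<close>.\<close>
  have "(\<lambda>n. 2 ^ (2 * p) * pi * fact (2 * p) *
          ((\<Sum>k. cbin k * G p k / (2 * real k + real n + 1)) / wseries n))
        \<longlonglongrightarrow> 2 ^ (2 * p) * pi * fact (2 * p) * ((pi / 2) ^ (2 * p) / fact (2 * p))"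
    by (intro tendsto_mult_left cbin_weighted_mean_tendsto G_tendsto)
  also have "2 ^ (2 * p) * pi * fact (2 * p) * ((pi / 2) ^ (2 * p) / fact (2 * p)) = pi ^ (2 * p + 1)"
    by (simp add: power_divide)
  also have "(\<lambda>n. 2 ^ (2 * p) * pi * fact (2 * p) *
          ((\<Sum>k. cbin k * G p k / (2 * real k + real n + 1)) / wseries n))
      = (\<lambda>n. 2 ^ (2 * p + n + 1) * fact (2 * p) / central_binom n *
          (\<Sum>k. cbin k * G p k / (2 * real k + real n + 1)))"
    by (simp add: fun_eq_iff central_binom_eq power_add)
  finally show "(\<lambda>n. 2 ^ (2 * p + n + 1) * fact (2 * p) / central_binom n *
          (\<Sum>k. real ((2 * k) choose k) * G p k / (4 ^ k * real (2 * k + n + 1))))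
        \<longlonglongrightarrow> pi ^ (2 * p + 1)"
    by (simp only: eq)
qed

lemma H_series:
  shows "summable (\<lambda>j. let k = Suc j in
            4 ^ k * H (Suc p) k / (real ((2 * k) choose k) * real k * real (2 * k + Suc m)))" (is ?S)
    and "(\<lambda>n. 2 ^ (2 * Suc p + n - 1) * fact (2 * Suc p - 1) / central_binom n *
          (\<Sum>j. let k = Suc j in
            4 ^ k * H (Suc p) k / (real ((2 * k) choose k) * real k * real (2 * k + n))))
        \<longlonglongrightarrow> pi ^ (2 * Suc p)" (is ?L)
proof -
  define c where "c = (\<lambda>k. 1 / (real k * cbin k ^ 2) * H (Suc p) k)"
  have c: "c \<longlonglongrightarrow> pi * ((pi / 2) ^ (2 * p) / fact (2 * p + 1))"
    unfolding c_def by (intro tendsto_mult inverse_cbin_square_tendsto H_tendsto)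
  define T where "T = (\<lambda>m k. cbin k * c k / (2 * real k + real m + 1))"
  \<comment> \<open>Division by zero makes \<open>c 0 = 0\<close>, so the sum from
    \<open>k = 1\<close> can start at 0.\<close>
  have T0: "T m 0 = 0" for m by (simp add: T_def c_def)
  have eq: "(let k = Suc j in 4 ^ k * H (Suc p) k / (real ((2 * k) choose k) * real k * real (2 * k + Suc m)))
      = T m (Suc j)" for j m
    by (simp add: T_def c_def cbin_def Let_def power2_eq_square divide_simps del: binomial_Suc_Suc)
  have sm: "summable (T m)" for m
    unfolding T_def using c by (intro summable_cbin) (auto simp: convergent_def)
  thus ?S unfolding eq by (subst summable_Suc_iff)
  have shift: "(\<Sum>j. T m (Suc j)) = suminf (T m)" for m
    using suminf_split_head[OF sm[of m]] T0 by simp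
  \<comment> \<open>With \<open>n = Suc m\<close> the denominator \<open>2 * k + n\<close> carries
    the weights of \<open>wseries m\<close>, whereas \<open>central_binom n\<close> involves
    \<open>wseries (Suc m)\<close>; the inserted ratio tends to 1.\<close>
  have "(\<lambda>m. 2 ^ (2 * p) * pi * fact (2 * p + 1) * ((wseries m / wseries (Suc m)) * (suminf (T m) / wseries m)))
     \<longlonglongrightarrow> 2 ^ (2 * p) * pi * fact (2 * p + 1) * (1 * (pi * ((pi / 2) ^ (2 * p) / fact (2 * p + 1))))"
    unfolding T_def
    by (intro tendsto_mult tendsto_const wseries_ratio_tendsto cbin_weighted_mean_tendsto c)
  also have "2 ^ (2 * p) * pi * fact (2 * p + 1) * (1 * (pi * ((pi / 2) ^ (2 * p) / fact (2 * p + 1))))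
      = pi ^ (2 * Suc p)"
    by (simp add: power_divide del: fact_Suc)
  also have "(\<lambda>m. 2 ^ (2 * p) * pi * fact (2 * p + 1) * ((wseries m / wseries (Suc m)) * (suminf (T m) / wseries m)))
      = (\<lambda>m. 2 ^ (2 * Suc p + Suc m - 1) * fact (2 * Suc p - 1) / central_binom (Suc m) * suminf (T m))"
  proof
    fix m
    have "wseries m \<noteq> 0" "wseries (Suc m) \<noteq> 0"
      using wseries_pos[of m] wseries_pos[of "Suc m"] by auto
    thus "2 ^ (2 * p) * pi * fact (2 * p + 1) * ((wseries m / wseries (Suc m)) * (suminf (T m) / wseries m))
      = 2 ^ (2 * Suc p + Suc m - 1) * fact (2 * Suc p - 1) / central_binom (Suc m) * suminf (T m)"
      by (simp add: central_binom_eq power_add del: fact_Suc)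
  qed
  finally show ?L
    by (subst filterlim_sequentially_Suc[symmetric]) (simp only: eq shift)
qed

theorem theorem4p1:
  "(\<forall>p::nat.
      (\<forall>n\<ge>1. summable (\<lambda>k::nat. real ((2 * k) choose k) * G p k / (4 ^ k * real (2 * k + n + 1)))) \<and>
      (\<lambda>n::nat. 2 ^ (2 * p + n + 1) * fact (2 * p) / central_binom n *
          (\<Sum>k::nat. real ((2 * k) choose k) * G p k / (4 ^ k * real (2 * k + n + 1))))
        \<longlonglongrightarrow> pi ^ (2 * p + 1)) \<and>
   (\<forall>p::nat. p \<ge> 1 \<longrightarrow>
      (\<forall>n\<ge>1. summable (\<lambda>j::nat. let k = Suc j in
              4 ^ k * H p k / (real ((2 * k) choose k) * real k * real (2 * k + n)))) \<and>
      (\<lambda>n::nat. 2 ^ (2 * p + n - 1) * fact (2 * p - 1) / central_binom n *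
          (\<Sum>j::nat. let k = Suc j in
              4 ^ k * H p k / (real ((2 * k) choose k) * real k * real (2 * k + n))))
        \<longlonglongrightarrow> pi ^ (2 * p))"
proof (intro conjI allI impI)
  fix p n :: nat
  assume "p \<ge> 1" "n \<ge> 1"
  then obtain q m where "p = Suc q" "n = Suc m"
    by (metis Suc_le_D One_nat_def)
  thus "summable (\<lambda>j. let k = Suc j in
      4 ^ k * H p k / (real ((2 * k) choose k) * real k * real (2 * k + n)))"
    using H_series(1) by blast
next
  fix p :: nat
  assume "p \<ge> 1"
  then obtain q where "p = Suc q"
    by (metis Suc_le_D One_nat_def)
  thus "(\<lambda>n. 2 ^ (2 * p + n - 1) * fact (2 * p - 1) / central_binom n *
      (\<Sum>j. let k = Suc j in 4 ^ k * H p k / (real ((2 * k) choose k) * real k * real (2 * k + n))))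
      \<longlonglongrightarrow> pi ^ (2 * p)"
    using H_series(2) by blast
qed (rule G_series)+

end
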